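(* Under Assumptions 1--4 listed in the context (with constants $G,M,R,\epsilon$) and the dual variable initialization $\boldsymbol\lambda_1=\mathbf 0$, if the primal and dual stepsizes of the MOSP recursion (see context) are chosen such that $\alpha=\mu=\mathcal O(T^{-1/3})$, where $T$ is the time horizon, then the dynamic fit $\mathrm{Fit}^{\rm d}_T:=\big\|\big[\sum_{t=1}^T\mathbf g_t(\mathbf x_t)\big]^+\big\|$ is upper-bounded by $$\mathrm{Fit}^{\rm d}_T=\mathcal O\!\left(M+\frac{2GR\,T^{1/3}+R^2T^{2/3}/2+M^2/2}{\epsilon-\bar V(\mathbf g)}\right)=\mathcal O(T^{2/3}).$$ In addition, if the temporal variations of the per-slot minimizers and of the constraints satisfy $V(\{\mathbf x_t^*\}_{t=1}^T):=\sum_{t=1}^T\|\mathbf x_t^*-\mathbf x_{t-1}^*\|=o(T^{2/3})$ and $V(\{\mathbf g_t\}_{t=1}^T):=\sum_{t=1}^TV(\mathbf g_t)=o(T^{2/3})$, then the dynamic regret $\mathrm{Reg}^{\rm d}_T:=\sum_{t=1}^Tf_t(\mathbf x_t)-\sum_{t=1}^Tf_t(\mathbf x_t^* )$ is sub-linearly increasing, i.e., $$\mathrm{Reg}^{\rm d}_T=o(T).$$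
   Context: Notation: $\|\cdot\|$ is the Euclidean norm, $[\mathbf a]^+:=\max\{\mathbf a,\mathbf 0\}$ entrywise, vector inequalities are entrywise, $\mathbf 1$ is the all-ones vector. Setting: $\mathcal X\subseteq\mathbb R^I$ is a fixed convex set. For each time slot $t$ there are a loss $f_t:\mathbb R^I\to\mathbb R$ and a constraint function $\mathbf g_t:\mathbb R^I\to\mathbb R^I$. The horizon consists of slots $t=1,\dots,T$; objects with index $0$ serve for initialization. Assumptions: 1. For every $t$, $f_t$ and $\mathbf g_t$ are convex. 2. For every $t$, $\|\nabla f_t(\mathbf x)\|\le G$ and $\|\mathbf g_t(\mathbf x)\|\le M$ for all $\mathbf x\in\mathcal X$. 3. $\|\mathbf x-\mathbf y\|\le R$ for all $\mathbf x,\mathbf y\in\mathcal X$. 4. There exist a constant $\epsilon>0$ and an interior point $\tilde{\mathbf x}\in\mathcal X$ such that $\mathbf g_t(\tilde{\mathbf x})\le-\epsilon\mathbf 1$ for all $t$. Per-slot minimizers: $\mathbf x_t^*\in\arg\min\{f_t(\mathbf x):\mathbf x\in\mathcal X,\ \mathbf g_t(\mathbf x)\le\mathbf 0\}$. Constraint variation: $V(\mathbf g_t):=\max_{\mathbf x\in\mathcal X}\|[\mathbf g_{t+1}(\mathbf x)-\mathbf g_t(\mathbf x)]^+\|$ and $\bar V(\mathbf g):=\max_tV(\mathbf g_t)$. MOSP recursion (modified online saddle-point method) with stepsizes $\alpha,\mu>0$: start from a primal iterate $\mathbf x_0\in\mathcal X$ and a dual iterate $\boldsymbol\lambda_1\in\mathbb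 R^I_+$; for $t=1,2,\dots$ let $\mathbf x_t$ be the minimizer over $\mathbf x\in\mathcal X$ of $$\nabla f_{t-1}(\mathbf x_{t-1})^\top(\mathbf x-\mathbf x_{t-1})+\boldsymbol\lambda_t^\top\mathbf g_{t-1}(\mathbf x)+\frac{1}{2\alpha}\|\mathbf x-\mathbf x_{t-1}\|^2,$$ and set $\boldsymbol\lambda_{t+1}=[\boldsymbol\lambda_t+\mu\,\mathbf g_t(\mathbf x_t)]^+$.
   Formalization: The stepsizes are taken of exact order T^{-1/3} (not merely at most that order), the maximal constraint variation is assumed smaller than ε, and Reg = o(T) is read as an upper bound (positive part of the regret is o(T)), since the literal forms fail or are undefined. *)

theory Defs
  imports "HOL-Analysis.Analysis" "HOL-Library.Landau_Symbols"
begin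

definition pos_part :: "real ^ 'i \<Rightarrow> real ^ 'i" where
  "pos_part a = (\<chi> i. max (a $ i) 0)"

(* The order on real ^ 'i is entrywise and 1 is the all-ones vector. The argument df is the
   gradient field of f (GDERIV determines it uniquely on X). Losses and constraints are indexed
   from 0, but the assumptions concern the time slots t \<ge> 1 only; the index-0 objects, which just
   initialize the recursion, need nothing beyond a gradient of f 0. *)
locale online_problem =
  fixes X :: "(real ^ 'i) set"
    and f :: "nat \<Rightarrow> real ^ 'i \<Rightarrow> real"
    and df :: "nat \<Rightarrow> real ^ 'i \<Rightarrow> real ^ 'i"
    and g :: "nat \<Rightarrow> real ^ 'i \<Rightarrow> real ^ 'i"
    and G M R \<epsilon> :: real
  assumes convex_X: "convex X"
    and gradient: "\<And>t x. x \<in> X \<Longrightarrow> GDERIV (f t) x :> df t x"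
    and convex_f: "\<And>t. t \<ge> 1 \<Longrightarrow> convex_on UNIV (f t)"
    and convex_g: "\<And>t i. t \<ge> 1 \<Longrightarrow> convex_on UNIV (\<lambda>x. g t x $ i)"
    and gradient_bound: "\<And>t x. t \<ge> 1 \<Longrightarrow> x \<in> X \<Longrightarrow> norm (df t x) \<le> G"
    and constraint_bound: "\<And>t x. t \<ge> 1 \<Longrightarrow> x \<in> X \<Longrightarrow> norm (g t x) \<le> M"
    and diameter_bound: "\<And>x y. x \<in> X \<Longrightarrow> y \<in> X \<Longrightarrow> norm (x - y) \<le> R"
    and slack_pos: "\<epsilon> > 0"
    and slater: "\<exists>z \<in> interior X. \<forall>t\<ge>1. g t z \<le> - \<epsilon> *\<^sub>R 1"

definition per_slot_minimizer ::
    "(real ^ 'i) set \<Rightarrow> (real ^ 'i \<Rightarrow> real) \<Rightarrow> (real ^ 'i \<Rightarrow> real ^ 'i) \<Rightarrow> real ^ 'i \<Rightarrow> bool" where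
  "per_slot_minimizer X h c z \<longleftrightarrow> is_arg_min h (\<lambda>x. x \<in> X \<and> c x \<le> 0) z"

(* The suprema below are over bounded nonempty sets under the assumptions of online_problem,
   and agree with the maxima whenever those are attained (X need not be closed). *)
definition slot_variation ::
    "(real ^ 'i) set \<Rightarrow> (nat \<Rightarrow> real ^ 'i \<Rightarrow> real ^ 'i) \<Rightarrow> nat \<Rightarrow> real" where
  "slot_variation X g t = (SUP x\<in>X. norm (pos_part (g (Suc t) x - g t x)))"

definition max_variation ::
    "(real ^ 'i) set \<Rightarrow> (nat \<Rightarrow> real ^ 'i \<Rightarrow> real ^ 'i) \<Rightarrow> real" where
  "max_variation X g = (SUP t\<in>{1..}. slot_variation X g t)"

definition total_variation ::
    "(real ^ 'i) set \<Rightarrow> (nat \<Rightarrow> real ^ 'i \<Rightarrow> real ^ 'i) \<Rightarrow> nat \<Rightarrow> real" where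
  "total_variation X g T = (\<Sum>t=1..T. slot_variation X g t)"

definition minimizer_variation :: "(nat \<Rightarrow> real ^ 'i) \<Rightarrow> nat \<Rightarrow> real" where
  "minimizer_variation xs T = (\<Sum>t=1..T. norm (xs t - xs (t - 1)))"

definition mosp_run ::
    "(real ^ 'i) set \<Rightarrow> (nat \<Rightarrow> real ^ 'i \<Rightarrow> real ^ 'i) \<Rightarrow> (nat \<Rightarrow> real ^ 'i \<Rightarrow> real ^ 'i) \<Rightarrow>
     real \<Rightarrow> real \<Rightarrow> (nat \<Rightarrow> real ^ 'i) \<Rightarrow> (nat \<Rightarrow> real ^ 'i) \<Rightarrow> bool" where
  "mosp_run X df g \<alpha> \<mu> x lam \<longleftrightarrow>
     x 0 \<in> X \<and> lam 1 \<ge> 0 \<and>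
     (\<forall>t\<ge>1.
        is_arg_min
          (\<lambda>y. df (t - 1) (x (t - 1)) \<bullet> (y - x (t - 1)) + lam t \<bullet> g (t - 1) y
               + 1 / (2 * \<alpha>) * (norm (y - x (t - 1)))\<^sup>2)
          (\<lambda>y. y \<in> X) (x t) \<and>
        lam (t + 1) = pos_part (lam t + \<mu> *\<^sub>R g t (x t)))"

definition dynamic_fit ::
    "(nat \<Rightarrow> real ^ 'i \<Rightarrow> real ^ 'i) \<Rightarrow> (nat \<Rightarrow> real ^ 'i) \<Rightarrow> nat \<Rightarrow> real" where
  "dynamic_fit g x T = norm (pos_part (\<Sum>t=1..T. g t (x t)))"

(* The dynamic regret can be negative of linear order, because iterates may violate individual
   per-slot constraints while the per-slot minimizers may not. Sublinear regret is therefore an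
   upper bound, i.e. a statement about max (dynamic_regret f x xs T) 0. *)
definition dynamic_regret ::
    "(nat \<Rightarrow> real ^ 'i \<Rightarrow> real) \<Rightarrow> (nat \<Rightarrow> real ^ 'i) \<Rightarrow> (nat \<Rightarrow> real ^ 'i) \<Rightarrow> nat \<Rightarrow> real" where
  "dynamic_regret f x xs T = (\<Sum>t=1..T. f t (x t)) - (\<Sum>t=1..T. f t (xs t))"

end

theory Submission
  imports Defs "HOL-Real_Asymp.Real_Asymp"
begin

text \<open>
  A drift argument on the squared dual norm keeps the dual iterates bounded: comparing the primal
  step with the Slater point makes the drift negative as soon as the dual norm exceeds
  (2GR + R^2/(2\<alpha>) + \<mu>M^2/2) / (\<epsilon> - max variation), and one step changes the dual iterate by at
  most \<mu>M. The dual update dominates the accumulated constraint values, so the fit is at most the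
  dual norm divided by \<mu>. For the regret, strong convexity of the proximal primal objective is
  used at the per-slot minimizers and summed against the same dual drift. The loss at slot 0,
  whose gradient is not bounded by G, only influences the choice of the first iterate, which may
  be an arbitrary point of X.
\<close>

section \<open>Entrywise order and positive parts\<close>

lemma pos_part_nonneg: "0 \<le> pos_part a"
  by (simp add: pos_part_def less_eq_vec_def)

lemma le_pos_part: "a \<le> pos_part a"
  by (simp add: pos_part_def less_eq_vec_def)

lemma norm_pos_part_le: "norm (pos_part a) \<le> norm a"
  by (rule norm_le_componentwise_cart) (auto simp: pos_part_def max_def)

lemma inner_mono_nonneg:
  fixes l a b :: "real ^ 'i"
  assumes "0 \<le> l" "a \<le> b"
  shows "l \<bullet> a \<le> l \<bullet> b"
  using assms by (auto simp: inner_vec_def less_eq_vec_def intro!: sum_mono mult_left_mono)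

text \<open>A nonnegative multiplier is raised only by increases of the constraint, so
  Cauchy-Schwarz is needed for the positive part alone. This matches the one-sided
  \<open>slot_variation\<close>.\<close>

lemma inner_le_norm_pos_part:
  fixes l a :: "real ^ 'i"
  assumes "0 \<le> l"
  shows "l \<bullet> a \<le> norm l * norm (pos_part a)"
  using inner_mono_nonneg[OF assms le_pos_part] norm_cauchy_schwarz order_trans by blast

text \<open>The 1-norm dominates the Euclidean norm. This turns the entrywise slack \<epsilon> at
  the Slater point into a gain linear in the dual norm.\<close>

lemma inner_one_ge_norm:
  fixes l :: "real ^ 'i"
  assumes "0 \<le> l"
  shows "norm l \<le> l \<bullet> 1"
proof -
  have "norm l \<le> (\<Sum>i\<in>UNIV. \<bar>l $ i\<bar>)" by (rule norm_le_l1_cart)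
  also have "\<dots> = l \<bullet> 1"
    using assms by (auto simp: inner_vec_def less_eq_vec_def intro!: sum.cong)
  finally show ?thesis .
qed

lemma norm_add_square:
  fixes a b :: "'a :: real_inner"
  shows "(norm (a + b))\<^sup>2 = (norm a)\<^sup>2 + 2 * (a \<bullet> b) + (norm b)\<^sup>2"
  by (simp add: power2_norm_eq_inner algebra_simps inner_commute)

section \<open>Convex functions\<close>

text \<open>Restriction to the line through \<open>x\<close> and \<open>y\<close> leaves the
  one-variable tangent inequality. Convexity on the whole space makes 0 interior to the domain of
  \<open>?h\<close>, even for \<open>x\<close> on the boundary of the feasible set.\<close>

lemma convex_on_UNIV_above_tangent:
  fixes f :: "'a :: real_inner \<Rightarrow> real"
  assumes "convex_on UNIV f" and "GDERIV f x :> d"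
  shows "f x - f y \<le> d \<bullet> (x - y)"
proof -
  let ?h = "\<lambda>u. f (x + u *\<^sub>R (y - x))"
  have cvx: "convex_on UNIV ?h"
  proof (rule convex_onI)
    fix t a b :: real
    assume "0 < t" "t < 1"
    have "x + ((1 - t) *\<^sub>R a + t *\<^sub>R b) *\<^sub>R (y - x)
        = (1 - t) *\<^sub>R (x + a *\<^sub>R (y - x)) + t *\<^sub>R (x + b *\<^sub>R (y - x))"
      by (simp add: algebra_simps)
    then show "?h ((1 - t) *\<^sub>R a + t *\<^sub>R b) \<le> (1 - t) * ?h a + t * ?h b"
      using convex_onD[OF assms(1), of t] \<open>0 < t\<close> \<open>t < 1\<close> by simp
  qed simp
  have "(f has_derivative (\<lambda>h. h \<bullet> d)) (at (x + 0 *\<^sub>R (y - x)))"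
    using assms(2) by (simp add: gderiv_def)
  then have "(?h has_derivative (\<lambda>u. (u *\<^sub>R (y - x)) \<bullet> d)) (at 0)"
    by (rule has_derivative_compose[rotated]) (auto intro!: derivative_eq_intros)
  then have "(?h has_field_derivative (y - x) \<bullet> d) (at 0)"
    by (simp add: has_field_derivative_def mult_commute_abs)
  then have "?h 1 - ?h 0 \<ge> ((y - x) \<bullet> d) * (1 - 0)"
    by (intro convex_on_imp_above_tangent[OF cvx]) auto
  then show ?thesis
    by (simp add: inner_commute inner_diff_right)
qed

lemma convex_on_inner_nonneg:
  fixes g :: "real ^ 'i \<Rightarrow> real ^ 'i"
  assumes "convex S" "0 \<le> l" "\<And>i. convex_on S (\<lambda>x. g x $ i)"
  shows "convex_on S (\<lambda>x. l \<bullet> g x)"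
proof -
  have "convex_on S (\<lambda>x. \<Sum>i\<in>I. l $ i * g x $ i)" if "finite I" for I
    using that
  proof (induction I)
    case (insert i I)
    then show ?case
      using assms by (auto simp: less_eq_vec_def intro!: convex_on_add convex_on_cmul)
  qed (simp add: convex_on_const assms(1))
  from this[of UNIV] show ?thesis by (simp add: inner_vec_def)
qed

text \<open>The square term is strongly convex, so the minimizer wins by an extra squared distance:
  compare \<open>x\<close> with a point of the segment towards \<open>z\<close>, divide by the
  weight of \<open>z\<close>, and let that weight tend to 0.\<close>

lemma proximal_minimizer_gap:
  fixes \<phi> :: "'a :: real_inner \<Rightarrow> real"
  assumes "convex_on X \<phi>" "c > 0"
    and min: "is_arg_min (\<lambda>y. \<phi> y + c * (norm (y - a))\<^sup>2) (\<lambda>y. y \<in> X) x"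
    and "z \<in> X"
  shows "\<phi> x + c * (norm (x - a))\<^sup>2 + c * (norm (z - x))\<^sup>2 \<le> \<phi> z + c * (norm (z - a))\<^sup>2"
proof -
  have "x \<in> X" using min by (simp add: is_arg_min_def)
  \<comment> \<open>Here \<open>v = 1 - u\<close> with \<open>u\<close> the weight of
    \<open>z\<close>, so the limit is \<open>v\<close> tending to 1, as supplied by
    \<open>field_le_mult_one_interval\<close>.\<close>
  have "v * (c * (norm (z - x))\<^sup>2)
      \<le> \<phi> z + c * (norm (z - a))\<^sup>2 - \<phi> x - c * (norm (x - a))\<^sup>2" (is "?l \<le> ?r")
    if v: "0 < v" "v < 1" for v
  proof -
    define u where "u = 1 - v"
    define w where "w = (1 - u) *\<^sub>R x + u *\<^sub>R z"
    have u: "0 < u" "u < 1" using v by (auto simp: u_def)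
    have "w \<in> X"
      unfolding w_def using convex_on_imp_convex[OF assms(1)] \<open>x \<in> X\<close> \<open>z \<in> X\<close> u
      by (intro convexD) auto
    then have 1: "\<phi> x + c * (norm (x - a))\<^sup>2 \<le> \<phi> w + c * (norm (w - a))\<^sup>2"
      using min by (force simp: is_arg_min_def)
    have 2: "\<phi> w \<le> (1 - u) * \<phi> x + u * \<phi> z"
      unfolding w_def using convex_onD[OF assms(1)] \<open>x \<in> X\<close> \<open>z \<in> X\<close> u by auto
    have w: "w - a = (1 - u) *\<^sub>R (x - a) + u *\<^sub>R (z - a)" and z: "z - x = (z - a) - (x - a)"
      by (auto simp: w_def algebra_simps)
    \<comment> \<open>Exact convexity defect of the squared norm; its last term is the source of the
      gap.\<close>
    have 3: "(norm (w - a))\<^sup>2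
        = (1 - u) * (norm (x - a))\<^sup>2 + u * (norm (z - a))\<^sup>2 - u * (1 - u) * (norm (z - x))\<^sup>2"
      unfolding w z power2_norm_eq_inner inner_add_left inner_add_right inner_diff_left
        inner_diff_right inner_scaleR_left inner_scaleR_right inner_commute[of "x - a" "z - a"]
      by algebra
    have "\<phi> x + c * (norm (x - a))\<^sup>2 \<le> (1 - u) * \<phi> x + u * \<phi> z + c * ((1 - u) * (norm (x - a))\<^sup>2
        + u * (norm (z - a))\<^sup>2 - u * (1 - u) * (norm (z - x))\<^sup>2)"
      using 1 2 unfolding 3 by linarith
    then have "u * ?l \<le> u * ?r"
      unfolding u_def by (simp add: algebra_simps)
    then show ?thesis using u by simp
  qed
  then have "c * (norm (z - x))\<^sup>2 \<le> \<phi> z + c * (norm (z - a))\<^sup>2 - \<phi> x - c * (norm (x - a))\<^sup>2"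
    by (rule field_le_mult_one_interval)
  then show ?thesis by simp
qed

section \<open>Slot variations\<close>

context online_problem
begin

lemma X_nonempty: "X \<noteq> {}"
  using slater interior_subset by blast

lemma bounds_nonneg: "0 \<le> G" "0 \<le> M" "0 \<le> R"
proof -
  obtain z where "z \<in> X" using X_nonempty by blast
  then show "0 \<le> G" "0 \<le> M" "0 \<le> R"
    using gradient_bound[of 1 z] constraint_bound[of 1 z] diameter_bound[of z z]
    by (auto intro: order_trans[OF norm_ge_zero])
qed

text \<open>The common bound \<open>2 * M\<close> makes the families under both suprema bounded, so
  that \<open>SUP\<close> is a genuine supremum.\<close>

lemma norm_pos_part_diff_bound:
  assumes "t \<ge> 1" "x \<in> X"
  shows "norm (pos_part (g (Suc t) x - g t x)) \<le> 2 * M"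
proof -
  have "norm (pos_part (g (Suc t) x - g t x)) \<le> norm (g (Suc t) x - g t x)"
    by (rule norm_pos_part_le)
  also have "\<dots> \<le> norm (g (Suc t) x) + norm (g t x)" by (rule norm_triangle_ineq4)
  also have "\<dots> \<le> 2 * M"
    using constraint_bound[of t x] constraint_bound[of "Suc t" x] assms by simp
  finally show ?thesis .
qed

lemma norm_pos_part_le_slot_variation:
  assumes "t \<ge> 1" "x \<in> X"
  shows "norm (pos_part (g (Suc t) x - g t x)) \<le> slot_variation X g t"
  unfolding slot_variation_def
  using norm_pos_part_diff_bound assms by (intro cSUP_upper) (auto intro!: bdd_aboveI[of _ "2 * M"])

lemma slot_variation_nonneg:
  assumes "t \<ge> 1"
  shows "0 \<le> slot_variation X g t"
  using norm_pos_part_le_slot_variation[OF assms] X_nonempty norm_ge_zero order_trans by blast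

lemma slot_variation_le_max_variation:
  assumes "t \<ge> 1"
  shows "slot_variation X g t \<le> max_variation X g"
proof -
  have "slot_variation X g s \<le> 2 * M" if "s \<ge> 1" for s
    unfolding slot_variation_def
    using norm_pos_part_diff_bound that X_nonempty by (intro cSUP_least) auto
  then show ?thesis
    unfolding max_variation_def using assms
    by (intro cSUP_upper) (auto intro!: bdd_aboveI[of _ "2 * M"])
qed

end

section \<open>A single run of the recursion\<close>

text \<open>Stepsizes are constants here, since each horizon has a run of its own.\<close>

locale mosp = online_problem +
  fixes \<alpha> \<mu> :: real and x lam
  assumes run: "mosp_run X df g \<alpha> \<mu> x lam"
    and lam_1: "lam 1 = 0"
    and primal_step_pos: "\<alpha> > 0"
    and dual_step_pos: "\<mu> > 0"
    and variation_less: "max_variation X g < \<epsilon>"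
begin

definition dual_bound :: real where
  "dual_bound = \<mu> * M + (2 * G * R + R\<^sup>2 / (2 * \<alpha>) + \<mu> * M\<^sup>2 / 2) / (\<epsilon> - max_variation X g)"

text \<open>Reindexed to start from slot 1, where the gradient and constraint bounds hold, and
  bracketed to fit \<open>proximal_minimizer_gap\<close> with weight
  \<open>1 / (2 * \<alpha>)\<close>.\<close>

lemma primal_step:
  assumes "t \<ge> 1"
  shows "is_arg_min (\<lambda>y. (df t (x t) \<bullet> (y - x t) + lam (Suc t) \<bullet> g t y)
      + 1 / (2 * \<alpha>) * (norm (y - x t))\<^sup>2) (\<lambda>y. y \<in> X) (x (Suc t))"
  using run by (auto simp: mosp_run_def dest!: spec[of _ "Suc t"])

lemma dual_step: "t \<ge> 1 \<Longrightarrow> lam (Suc t) = pos_part (lam t + \<mu> *\<^sub>R g t (x t))"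
  using run by (auto simp: mosp_run_def)

lemma x_in_X: "t \<ge> 1 \<Longrightarrow> x t \<in> X"
  using run by (auto simp: mosp_run_def is_arg_min_def)

lemma lam_nonneg: "t \<ge> 1 \<Longrightarrow> 0 \<le> lam t"
  using lam_1 dual_step pos_part_nonneg by (cases t; cases "t - 1") auto

section \<open>Drift estimates and boundedness of the dual iterates\<close>

lemma dual_drift:
  assumes "t \<ge> 1"
  shows "(norm (lam (Suc t)))\<^sup>2 \<le> (norm (lam t))\<^sup>2 + 2 * \<mu> * (lam t \<bullet> g t (x t)) + \<mu>\<^sup>2 * M\<^sup>2"
proof -
  have "(norm (lam (Suc t)))\<^sup>2 \<le> (norm (lam t + \<mu> *\<^sub>R g t (x t)))\<^sup>2"
    unfolding dual_step[OF assms] by (intro power_mono norm_pos_part_le) simp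
  also have "\<dots> = (norm (lam t))\<^sup>2 + 2 * \<mu> * (lam t \<bullet> g t (x t)) + \<mu>\<^sup>2 * (norm (g t (x t)))\<^sup>2"
    by (simp add: norm_add_square power_mult_distrib)
  also have "\<dots> \<le> (norm (lam t))\<^sup>2 + 2 * \<mu> * (lam t \<bullet> g t (x t)) + \<mu>\<^sup>2 * M\<^sup>2"
    using constraint_bound[OF assms x_in_X[OF assms]]
    by (intro add_left_mono mult_left_mono power_mono) auto
  finally show ?thesis .
qed

lemma norm_dual_step:
  assumes "t \<ge> 1"
  shows "norm (lam (Suc t)) \<le> norm (lam t) + \<mu> * M"
proof -
  have "norm (lam (Suc t)) \<le> norm (lam t + \<mu> *\<^sub>R g t (x t))"
    unfolding dual_step[OF assms] by (rule norm_pos_part_le)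
  also have "\<dots> \<le> norm (lam t) + norm (\<mu> *\<^sub>R g t (x t))" by (rule norm_triangle_ineq)
  also have "\<dots> \<le> norm (lam t) + \<mu> * M"
    using constraint_bound[OF assms x_in_X[OF assms]] dual_step_pos by (simp add: mult_left_mono)
  finally show ?thesis .
qed

text \<open>The primal step sees \<open>g t\<close> but the next dual update sees
  \<open>g (Suc t)\<close>; the slot variation pays for the mismatch.\<close>

lemma inner_constraint_shift:
  assumes "t \<ge> 1"
  shows "lam (Suc t) \<bullet> g (Suc t) (x (Suc t))
    \<le> lam (Suc t) \<bullet> g t (x (Suc t)) + norm (lam (Suc t)) * slot_variation X g t"
proof -
  let ?d = "g (Suc t) (x (Suc t)) - g t (x (Suc t))"
  have "lam (Suc t) \<bullet> ?d \<le> norm (lam (Suc t)) * norm (pos_part ?d)"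
    by (intro inner_le_norm_pos_part lam_nonneg) simp
  also have "\<dots> \<le> norm (lam (Suc t)) * slot_variation X g t"
    using assms by (intro mult_left_mono norm_pos_part_le_slot_variation x_in_X) auto
  finally show ?thesis by (simp add: inner_diff_right)
qed

lemma inner_constraint_le:
  assumes "t \<ge> 1"
  shows "lam (Suc t) \<bullet> g (Suc t) (x (Suc t))
    \<le> 2 * G * R + R\<^sup>2 / (2 * \<alpha>) - (\<epsilon> - max_variation X g) * norm (lam (Suc t))"
proof -
  obtain z where z: "z \<in> X" "g t z \<le> - \<epsilon> *\<^sub>R 1"
    using slater interior_subset assms by blast
  let ?l = "lam (Suc t)" and ?d = "df t (x t)" and ?y = "x (Suc t)"
  have l: "0 \<le> ?l" and y: "?y \<in> X" by (simp_all add: lam_nonneg x_in_X)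
  have "?d \<bullet> (?y - x t) + ?l \<bullet> g t ?y + 1 / (2 * \<alpha>) * (norm (?y - x t))\<^sup>2
      \<le> ?d \<bullet> (z - x t) + ?l \<bullet> g t z + 1 / (2 * \<alpha>) * (norm (z - x t))\<^sup>2"
    using primal_step[OF assms] z(1) by (force simp: is_arg_min_def)
  moreover have "0 \<le> 1 / (2 * \<alpha>) * (norm (?y - x t))\<^sup>2"
    using primal_step_pos by simp
  moreover have "1 / (2 * \<alpha>) * (norm (z - x t))\<^sup>2 \<le> 1 / (2 * \<alpha>) * R\<^sup>2"
    using primal_step_pos assms z(1)
    by (intro mult_left_mono power_mono diameter_bound x_in_X) auto
  moreover have "?d \<bullet> (z - x t) - ?d \<bullet> (?y - x t) \<le> G * R"
  proof -
    have "?d \<bullet> (z - x t) - ?d \<bullet> (?y - x t) = ?d \<bullet> (z - ?y)" by (simp add: inner_diff_right)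
    also have "\<dots> \<le> norm ?d * norm (z - ?y)" by (rule norm_cauchy_schwarz)
    also have "\<dots> \<le> G * R"
      using assms z(1) y bounds_nonneg
      by (intro mult_mono gradient_bound diameter_bound x_in_X) auto
    finally show ?thesis .
  qed
  moreover have "?l \<bullet> g t z \<le> - \<epsilon> * norm ?l"
  proof -
    have "?l \<bullet> g t z \<le> ?l \<bullet> (- \<epsilon> *\<^sub>R 1)" by (rule inner_mono_nonneg[OF l z(2)])
    also have "\<dots> \<le> - \<epsilon> * norm ?l" using inner_one_ge_norm[OF l] slack_pos by simp
    finally show ?thesis .
  qed
  moreover have "norm ?l * slot_variation X g t \<le> norm ?l * max_variation X g"
    using assms by (intro mult_left_mono slot_variation_le_max_variation) auto
  \<comment> \<open>The comparison costs a single \<open>G * R\<close>; the doubled constant is the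
    one in the stated fit bound.\<close>
  moreover have "G * R \<le> 2 * G * R" using bounds_nonneg by simp
  ultimately show ?thesis
    using inner_constraint_shift[OF assms] by (simp add: algebra_simps)
qed

lemma norm_lam_le:
  assumes "t \<ge> 1"
  shows "norm (lam t) \<le> dual_bound"
  using assms
proof (induction t rule: dec_induct)
  case base
  then show ?case
    using lam_1 bounds_nonneg primal_step_pos dual_step_pos variation_less
    by (simp add: dual_bound_def)
next
  case (step t)
  let ?e = "\<epsilon> - max_variation X g"
  let ?N = "2 * G * R + R\<^sup>2 / (2 * \<alpha>) + \<mu> * M\<^sup>2 / 2"
  have e: "?e > 0" using variation_less by simp
  show ?case
  proof (cases "norm (lam t) \<le> ?N / ?e")
    \<comment> \<open>Below the threshold, one update overshoots by at most
      \<open>\<mu> * M\<close>, the first summand of \<open>dual_bound\<close>.\<close>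
    case True
    then show ?thesis
      using norm_dual_step[of t] step by (simp add: dual_bound_def)
  next
    case False
    have "0 \<le> ?N / ?e"
      using bounds_nonneg primal_step_pos dual_step_pos e by simp
    \<comment> \<open>At slot 1 the dual iterate is 0, hence below the threshold. So
      \<open>t\<close> has a predecessor \<open>s \<ge> 1\<close>, as
      \<open>inner_constraint_le\<close> demands.\<close>
    then have "t \<noteq> 1" using False lam_1 by auto
    then obtain s where s: "t = Suc s" "s \<ge> 1" using step by (cases t) auto
    have "?N < ?e * norm (lam t)" using False e by (simp add: field_simps)
    then have "lam t \<bullet> g t (x t) + \<mu> * M\<^sup>2 / 2 \<le> 0"
      using inner_constraint_le[OF s(2)] by (simp add: s(1))
    then have "2 * \<mu> * (lam t \<bullet> g t (x t) + \<mu> * M\<^sup>2 / 2) \<le> 0"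
      using dual_step_pos by (intro mult_nonneg_nonpos) auto
    then have "(norm (lam (Suc t)))\<^sup>2 \<le> (norm (lam t))\<^sup>2"
      using dual_drift[of t] step by (simp add: algebra_simps power2_eq_square)
    then have "norm (lam (Suc t)) \<le> norm (lam t)" by (simp add: power2_le_iff_abs_le)
    then show ?thesis using step by simp
  qed
qed

section \<open>Dynamic fit of a run\<close>

lemma sum_constraint_le_lam: "\<mu> *\<^sub>R (\<Sum>t=1..n. g t (x t)) \<le> lam (Suc n)"
proof (induction n)
  case 0
  then show ?case using lam_1 by simp
next
  case (Suc n)
  have "\<mu> *\<^sub>R (\<Sum>t=1..Suc n. g t (x t)) \<le> lam (Suc n) + \<mu> *\<^sub>R g (Suc n) (x (Suc n))"
    using Suc by (simp add: scaleR_right_distrib)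
  \<comment> \<open>Clipping at 0 only raises entries, so the dual iterate never falls below the
    scaled constraint sum.\<close>
  also have "\<dots> \<le> lam (Suc (Suc n))" by (simp add: dual_step le_pos_part)
  finally show ?case .
qed

text \<open>The final dual iterate divided by \<mu> dominates both the constraint sum and 0, hence
  the positive part of the sum, entry by entry.\<close>

lemma dynamic_fit_le: "dynamic_fit g x n \<le> dual_bound / \<mu>"
proof -
  let ?S = "\<Sum>t=1..n. g t (x t)"
  have "norm (pos_part ?S) \<le> norm ((1 / \<mu>) *\<^sub>R lam (Suc n))"
  proof (rule norm_le_componentwise_cart)
    fix i
    have "\<mu> * ?S $ i \<le> lam (Suc n) $ i" "0 \<le> lam (Suc n) $ i"
      using sum_constraint_le_lam[of n] lam_nonneg[of "Suc n"] by (simp_all add: less_eq_vec_def)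
    then have "?S $ i \<le> lam (Suc n) $ i / \<mu>" "0 \<le> lam (Suc n) $ i / \<mu>" "0 \<le> lam (Suc n) $ i"
      using dual_step_pos by (simp_all add: field_simps)
    then show "norm (pos_part ?S $ i) \<le> norm (((1 / \<mu>) *\<^sub>R lam (Suc n)) $ i)"
      using dual_step_pos by (simp add: pos_part_def max_def abs_of_pos del: sum_component)
  qed
  also have "\<dots> = norm (lam (Suc n)) / \<mu>" using dual_step_pos by simp
  also have "\<dots> \<le> dual_bound / \<mu>"
    using dual_step_pos norm_lam_le[of "Suc n"] by (intro divide_right_mono) auto
  finally show ?thesis by (simp add: dynamic_fit_def)
qed

section \<open>Dynamic regret of a run\<close>

text \<open>Convexity bounds the loss difference by a gradient term, which the proximal gap trades
  for distances to \<open>z\<close>. Feasibility of \<open>z\<close> makes its multiplier term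
  nonpositive; the one at \<open>x (Suc t)\<close> is moved to slot \<open>Suc t\<close> and
  absorbed by the dual drift there, hence the shifted dual indices.\<close>

lemma regret_step:
  assumes t: "t \<ge> 1" and z: "z \<in> X" "g t z \<le> 0"
  shows "f t (x t) - f t z \<le> \<alpha> * G\<^sup>2 / 2 + \<mu> * M\<^sup>2 / 2 + dual_bound * slot_variation X g t
    + ((norm (lam (Suc t)))\<^sup>2 - (norm (lam (Suc (Suc t))))\<^sup>2) / (2 * \<mu>)
    + ((norm (z - x t))\<^sup>2 - (norm (z - x (Suc t)))\<^sup>2) / (2 * \<alpha>)"
proof -
  let ?l = "lam (Suc t)" and ?d = "df t (x t)" and ?y = "x (Suc t)"
  let ?c = "1 / (2 * \<alpha>)"
  have l: "0 \<le> ?l" and y: "?y \<in> X" by (simp_all add: lam_nonneg x_in_X)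
  have "f t (x t) - f t z \<le> ?d \<bullet> (x t - z)"
    using convex_on_UNIV_above_tangent[OF convex_f[OF t] gradient] x_in_X[OF t] by blast
  moreover have "?d \<bullet> (?y - x t) + ?l \<bullet> g t ?y + ?c * (norm (?y - x t))\<^sup>2 + ?c * (norm (z - ?y))\<^sup>2
      \<le> ?d \<bullet> (z - x t) + ?l \<bullet> g t z + ?c * (norm (z - x t))\<^sup>2"
  proof (rule proximal_minimizer_gap[OF _ _ primal_step[OF t] z(1)])
    have "convex_on X (\<lambda>y. ?l \<bullet> g t y)"
      using convex_g[OF t] convex_X l
      by (intro convex_on_inner_nonneg) (auto intro: convex_on_subset)
    moreover have "convex_on X (\<lambda>y. ?d \<bullet> (y - x t))"
      using convex_X by (auto intro!: convex_onI simp: algebra_simps)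
    ultimately show "convex_on X (\<lambda>y. ?d \<bullet> (y - x t) + ?l \<bullet> g t y)"
      by (intro convex_on_add)
  qed (use primal_step_pos in simp)
  moreover have "?l \<bullet> g t z \<le> 0"
    using inner_mono_nonneg[OF l z(2)] by simp
  \<comment> \<open>Young's inequality: the proximal square pays for the movement of the primal
    iterate, leaving a term of order \<alpha>.\<close>
  moreover have "?d \<bullet> (x t - ?y) - ?c * (norm (?y - x t))\<^sup>2 \<le> \<alpha> * G\<^sup>2 / 2"
  proof -
    let ?n = "norm (?y - x t)"
    have "?d \<bullet> (x t - ?y) \<le> norm ?d * norm (x t - ?y)" by (rule norm_cauchy_schwarz)
    also have "\<dots> \<le> G * ?n"
      using gradient_bound[OF t x_in_X[OF t]] by (simp add: norm_minus_commute mult_right_mono)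
    also have "\<dots> \<le> \<alpha> * G\<^sup>2 / 2 + ?c * ?n\<^sup>2"
    proof -
      have "0 \<le> (\<alpha> * G - ?n)\<^sup>2 / (2 * \<alpha>)" using primal_step_pos by simp
      also have "\<dots> = \<alpha> * G\<^sup>2 / 2 + ?c * ?n\<^sup>2 - G * ?n"
        using primal_step_pos by (simp add: field_simps power2_eq_square)
      finally show ?thesis by simp
    qed
    finally show ?thesis by simp
  qed
  \<comment> \<open>The dual drift of slot \<open>Suc t\<close>, solved for the multiplier
    term.\<close>
  moreover have "- (?l \<bullet> g (Suc t) ?y)
      \<le> \<mu> * M\<^sup>2 / 2 + ((norm ?l)\<^sup>2 - (norm (lam (Suc (Suc t))))\<^sup>2) / (2 * \<mu>)"
    using dual_drift[of "Suc t"] dual_step_pos by (simp add: field_simps power2_eq_square)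
  moreover have "?l \<bullet> g (Suc t) ?y \<le> ?l \<bullet> g t ?y + norm ?l * slot_variation X g t"
    by (rule inner_constraint_shift[OF t])
  moreover have "norm ?l * slot_variation X g t \<le> dual_bound * slot_variation X g t"
    using norm_lam_le[of "Suc t"] slot_variation_nonneg[OF t] by (simp add: mult_right_mono)
  moreover have "?d \<bullet> (x t - z) + ?d \<bullet> (z - x t) = 0"
    "?d \<bullet> (?y - x t) + ?d \<bullet> (x t - ?y) = 0"
    by (simp_all add: inner_diff_right)
  ultimately show ?thesis
    by (simp add: diff_divide_distrib)
qed

text \<open>Sum of \<open>regret_step\<close> at the moving comparators \<open>xs t\<close>. The
  dual norms telescope; the distances do so after \<open>xs t\<close> is exchanged for
  \<open>xs (Suc t)\<close>, at a price of at most \<open>2 * R * w t\<close>.\<close>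

lemma dynamic_regret_le:
  assumes xs: "\<And>t. t \<ge> 1 \<Longrightarrow> per_slot_minimizer X (f t) (g t) (xs t)"
  shows "dynamic_regret f x xs n \<le> real n * (\<alpha> * G\<^sup>2 / 2 + \<mu> * M\<^sup>2 / 2) + \<mu> * M\<^sup>2 / 2
    + dual_bound * total_variation X g n + (3 * R\<^sup>2 + 2 * R * minimizer_variation xs n) / (2 * \<alpha>)"
proof -
  have xs_X: "xs t \<in> X" and xs_g: "g t (xs t) \<le> 0" if "t \<ge> 1" for t
    using xs[OF that] by (auto simp: per_slot_minimizer_def is_arg_min_def)
  define w where "w t = norm (xs (Suc t) - xs t)" for t
  define d where "d t = (norm (xs t - x t))\<^sup>2" for t
  define p where "p t = (norm (lam (Suc t)))\<^sup>2" for t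
  let ?c = "\<alpha> * G\<^sup>2 / 2 + \<mu> * M\<^sup>2 / 2"
  have d_step: "d (Suc t) - 2 * R * w t \<le> (norm (xs t - x (Suc t)))\<^sup>2" if t: "t \<ge> 1" for t
  proof -
    let ?a = "norm (xs (Suc t) - x (Suc t))" and ?b = "norm (xs t - x (Suc t))"
    have "?a\<^sup>2 - ?b\<^sup>2 = (?a + ?b) * (?a - ?b)" by algebra
    also have "\<dots> \<le> (?a + ?b) * w t"
      using norm_triangle_ineq2[of "xs (Suc t) - x (Suc t)" "xs t - x (Suc t)"]
      by (intro mult_left_mono) (auto simp: w_def)
    also have "\<dots> \<le> (R + R) * w t"
      using t by (intro mult_right_mono add_mono diameter_bound xs_X x_in_X) (auto simp: w_def)
    finally show ?thesis by (simp add: d_def)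
  qed
  have step: "f t (x t) - f t (xs t) \<le> ?c + dual_bound * slot_variation X g t
      + (p t - p (Suc t)) / (2 * \<mu>) + (d t - d (Suc t) + 2 * R * w t) / (2 * \<alpha>)" if t: "t \<ge> 1" for t
  proof -
    have "(d t - (norm (xs t - x (Suc t)))\<^sup>2) / (2 * \<alpha>) \<le> (d t - d (Suc t) + 2 * R * w t) / (2 * \<alpha>)"
      using d_step[OF t] primal_step_pos by (intro divide_right_mono) auto
    then show ?thesis
      using regret_step[OF t xs_X[OF t] xs_g[OF t]] by (simp add: p_def d_def)
  qed
  have telescope: "(\<Sum>t=1..n. f t (x t) - f t (xs t)) \<le> real n * ?c
      + dual_bound * total_variation X g n + (p 1 - p (Suc n)) / (2 * \<mu>)
      + (d 1 - d (Suc n) + 2 * R * (\<Sum>t=1..n. w t)) / (2 * \<alpha>)" for n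
  proof (induction n)
    case (Suc n)
    then show ?case
      using step[of "Suc n"]
      by (simp add: total_variation_def add_divide_distrib diff_divide_distrib algebra_simps)
  qed (simp add: total_variation_def)
  \<comment> \<open>The dual sum starts at \<open>lam 2\<close>, one drift away from
    \<open>lam 1 = 0\<close>; this causes the isolated \<mu> term outside the factor
    \<open>real n\<close>.\<close>
  have p_1: "p 1 \<le> \<mu>\<^sup>2 * M\<^sup>2"
    using dual_drift[of 1] lam_1 by (simp add: p_def)
  have "(p 1 - p (Suc n)) / (2 * \<mu>) \<le> \<mu>\<^sup>2 * M\<^sup>2 / (2 * \<mu>)"
    using p_1 dual_step_pos zero_le_power2[of "norm (lam (Suc (Suc n)))"]
    unfolding p_def by (intro divide_right_mono; linarith)
  then have p: "(p 1 - p (Suc n)) / (2 * \<mu>) \<le> \<mu> * M\<^sup>2 / 2"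
    using dual_step_pos by (simp add: power2_eq_square)
  \<comment> \<open>\<open>w\<close> looks forward and \<open>minimizer_variation\<close> backward:
    the first \<open>n - 1\<close> forward steps occur in the latter, its term with
    \<open>xs 0\<close> is dropped, and the step to \<open>xs (n + 1)\<close> costs at most
    \<open>R\<close>.\<close>
  have "(\<Sum>t=1..n. w t) \<le> minimizer_variation xs n + R"
  proof (cases n)
    case 0
    then show ?thesis using bounds_nonneg by (simp add: minimizer_variation_def)
  next
    case (Suc m)
    have "(\<Sum>t=1..m. w t) = (\<Sum>t=Suc 1..Suc m. norm (xs t - xs (t - 1)))"
      unfolding sum.shift_bounds_cl_Suc_ivl by (simp add: w_def)
    also have "\<dots> \<le> minimizer_variation xs n"
      unfolding minimizer_variation_def Suc by (intro sum_mono2) auto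
    finally have "(\<Sum>t=1..m. w t) \<le> minimizer_variation xs n" .
    moreover have "w n \<le> R"
      unfolding w_def using Suc by (intro diameter_bound xs_X) auto
    ultimately show ?thesis using Suc by simp
  qed
  then have "2 * R * (\<Sum>t=1..n. w t) \<le> 2 * R * (minimizer_variation xs n + R)"
    using bounds_nonneg by (intro mult_left_mono) auto
  moreover have "d 1 \<le> R\<^sup>2"
    unfolding d_def by (intro power_mono diameter_bound xs_X x_in_X) auto
  moreover have "0 \<le> d (Suc n)" by (simp add: d_def)
  \<comment> \<open>One squared \<open>R\<close> comes from \<open>d 1\<close>, the other two from
    the last step of \<open>w\<close>.\<close>
  ultimately have "d 1 - d (Suc n) + 2 * R * (\<Sum>t=1..n. w t)
      \<le> 3 * R\<^sup>2 + 2 * R * minimizer_variation xs n"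
    by (simp add: algebra_simps power2_eq_square)
  then have "(d 1 - d (Suc n) + 2 * R * (\<Sum>t=1..n. w t)) / (2 * \<alpha>)
      \<le> (3 * R\<^sup>2 + 2 * R * minimizer_variation xs n) / (2 * \<alpha>)"
    using primal_step_pos by (intro divide_right_mono) auto
  then show ?thesis
    using telescope[of n] p unfolding dynamic_regret_def sum_subtractf by argo
qed

end

section \<open>Asymptotics\<close>

text \<open>The finitely many early ratios are added to the eventual constant, which gives a bound
  from slot 1 on.\<close>

lemma bigo_nat_uniform_bound:
  fixes h k :: "nat \<Rightarrow> real"
  assumes "h \<in> O(k)" and k: "\<And>n. n \<ge> 1 \<Longrightarrow> k n > 0"
  obtains c where "c > 0" "\<And>n. n \<ge> 1 \<Longrightarrow> \<bar>h n\<bar> \<le> c * k n"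
proof -
  obtain c N where c: "c > 0" and N: "\<And>n. n \<ge> N \<Longrightarrow> \<bar>h n\<bar> \<le> c * \<bar>k n\<bar>"
    using landau_o.bigE[OF assms(1)] unfolding eventually_sequentially real_norm_def by metis
  define s where "s = (\<Sum>n=1..N. \<bar>h n\<bar> / k n)"
  have s: "0 \<le> s" unfolding s_def using k by (intro sum_nonneg) (simp add: less_imp_le)
  have "\<bar>h n\<bar> \<le> (c + s) * k n" if n: "n \<ge> 1" for n
  proof (cases "n \<ge> N")
    case True
    have "\<bar>h n\<bar> \<le> c * k n" using N[OF True] k[OF n] by simp
    also have "\<dots> \<le> (c + s) * k n" using s k[OF n] by (intro mult_right_mono) auto
    finally show ?thesis .
  next
    case False
    have "\<bar>h n\<bar> / k n \<le> s"
      unfolding s_def using n False k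
      by (intro member_le_sum) (auto simp: less_imp_le)
    then have "\<bar>h n\<bar> \<le> s * k n" using k[OF n] by (simp add: field_simps)
    also have "\<dots> \<le> (c + s) * k n" using c k[OF n] by (intro mult_right_mono) auto
    finally show ?thesis .
  qed
  then show ?thesis using c s that[of "c + s"] by auto
qed

text \<open>The exponents add up to 1; this is where variations of order below
  \<open>T powr (2 / 3)\<close> become sublinear regret.\<close>

lemma third_power_mult_smallo:
  assumes "h \<in> O(\<lambda>T. real T powr (1 / 3))" "k \<in> o(\<lambda>T. real T powr (2 / 3))"
  shows "(\<lambda>T. h T * k T) \<in> o(\<lambda>T. real T)"
proof -
  have "(\<lambda>T. h T * k T) \<in> o(\<lambda>T. real T powr (1 / 3) * real T powr (2 / 3))"
    by (rule landau_o.big_small_mult[OF assms])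
  also have "(\<lambda>T. real T powr (1 / 3) * real T powr (2 / 3)) = (\<lambda>T. real T)"
    by (simp flip: powr_add)
  finally show ?thesis .
qed

text \<open>\<open>C\<close> is chosen before the problem data, so it depends on the stepsizes only.
  Their order is two-sided because the fit bound involves \<open>1 / \<alpha> T\<close>, which an
  upper order alone does not control. All horizons share one problem, each with its own run.\<close>

theorem corollary1:
  fixes \<alpha> \<mu> :: "nat \<Rightarrow> real"
  assumes stepsize_pos: "\<And>T. T \<ge> 1 \<Longrightarrow> \<alpha> T > 0"
    and stepsize_eq: "\<And>T. T \<ge> 1 \<Longrightarrow> \<mu> T = \<alpha> T"
    and stepsize_order: "\<alpha> \<in> \<Theta>(\<lambda>T. real T powr (- 1 / 3))"
  shows "\<exists>C. \<forall>(X :: (real ^ 'i) set) f df g G M R \<epsilon> xs x lam.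
    online_problem X f df g G M R \<epsilon> \<longrightarrow>
    max_variation X g < \<epsilon> \<longrightarrow>
    (\<forall>t\<ge>1. per_slot_minimizer X (f t) (g t) (xs t)) \<longrightarrow>
    (\<forall>T\<ge>1. mosp_run X df g (\<alpha> T) (\<mu> T) (x T) (lam T) \<and> lam T 1 = 0) \<longrightarrow>
      (\<forall>T\<ge>1. dynamic_fit g (x T) T
          \<le> C * (M + (2 * G * R * real T powr (1 / 3) + R\<^sup>2 * real T powr (2 / 3) / 2 + M\<^sup>2 / 2)
                     / (\<epsilon> - max_variation X g))) \<and>
      (\<lambda>T. dynamic_fit g (x T) T) \<in> O(\<lambda>T. real T powr (2 / 3)) \<and>
      (minimizer_variation xs \<in> o(\<lambda>T. real T powr (2 / 3)) \<longrightarrow>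
       total_variation X g \<in> o(\<lambda>T. real T powr (2 / 3)) \<longrightarrow>
       (\<lambda>T. max (dynamic_regret f (x T) xs T) 0) \<in> o(\<lambda>T. real T))"
proof -
  have \<alpha>_bigo: "\<alpha> \<in> O(\<lambda>T. real T powr (- 1 / 3))"
    using stepsize_order by (rule bigthetaD1)
  have "(\<lambda>T. real T powr (- 1 / 3)) \<in> O(\<alpha>)"
    using stepsize_order by (simp add: bigtheta_def bigomega_iff_bigo)
  then obtain b where b: "b > 0" "\<And>T. T \<ge> 1 \<Longrightarrow> \<bar>real T powr (- 1 / 3)\<bar> \<le> b * \<alpha> T"
    using bigo_nat_uniform_bound stepsize_pos by metis
  \<comment> \<open>The maximum with 1 makes the square of \<open>K\<close> dominate 1 and
    \<open>K\<close>, so one constant serves every summand of the fit bound.\<close>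
  define K where "K = max b 1"
  have K: "K \<ge> 1" "K \<le> K\<^sup>2" using self_le_power[of K 2] by (auto simp: K_def)
  have inv1: "1 / \<alpha> T \<le> K * real T powr (1 / 3)" if T: "T \<ge> 1" for T
  proof -
    have "1 = real T powr (- 1 / 3) * real T powr (1 / 3)"
      using T by (simp flip: powr_add)
    also have "\<dots> \<le> (b * \<alpha> T) * real T powr (1 / 3)"
      using b(2)[OF T] by (intro mult_right_mono) auto
    also have "\<dots> \<le> (K * \<alpha> T) * real T powr (1 / 3)"
      using stepsize_pos[OF T] by (intro mult_right_mono) (auto simp: K_def)
    finally show ?thesis using stepsize_pos[OF T] by (simp add: field_simps)
  qed
  have inv2: "1 / (\<alpha> T)\<^sup>2 \<le> K\<^sup>2 * real T powr (2 / 3)" if T: "T \<ge> 1" for T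
  proof -
    have "(1 / \<alpha> T)\<^sup>2 \<le> (K * real T powr (1 / 3))\<^sup>2"
      using inv1[OF T] stepsize_pos[OF T] by (intro power_mono) auto
    also have "\<dots> = K\<^sup>2 * real T powr (2 / 3)"
      by (simp add: power2_eq_square flip: powr_add)
    finally show ?thesis by (simp add: power_divide)
  qed
  have inv_bigo: "(\<lambda>T. 1 / \<alpha> T) \<in> O(\<lambda>T. real T powr (1 / 3))"
    using inv1 stepsize_pos
    by (intro bigoI[of _ K] eventually_sequentiallyI[of 1]) (auto simp: less_imp_le abs_of_pos)
  show ?thesis
  proof (intro exI[of _ "K\<^sup>2"] allI impI)
    fix X :: "(real ^ 'i) set" and f df g G M R \<epsilon> xs x lam
    assume problem: "online_problem X f df g G M R \<epsilon>"
      and variation: "max_variation X g < \<epsilon>"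
      and minimizers: "\<forall>t\<ge>1. per_slot_minimizer X (f t) (g t) (xs t)"
      and runs: "\<forall>T\<ge>1. mosp_run X df g (\<alpha> T) (\<mu> T) (x T) (lam T) \<and> lam T 1 = 0"
    interpret online_problem X f df g G M R \<epsilon> by (rule problem)
    have mosp: "mosp X f df g G M R \<epsilon> (\<alpha> T) (\<alpha> T) (x T) (lam T)" if "T \<ge> 1" for T
      using that runs stepsize_pos[OF that] stepsize_eq[OF that] variation
      by unfold_locales auto
    define e where "e = \<epsilon> - max_variation X g"
    have e: "e > 0" using variation by (simp add: e_def)
    define L where "L T = \<alpha> T * M + (2 * G * R + R\<^sup>2 / (2 * \<alpha> T) + \<alpha> T * M\<^sup>2 / 2) / e" for T
    have L: "mosp.dual_bound X g G M R \<epsilon> (\<alpha> T) (\<alpha> T) = L T" if "T \<ge> 1" for T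
      using mosp.dual_bound_def[OF mosp[OF that]] by (simp add: L_def e_def)
    define F where
      "F T = M + (2 * G * R * real T powr (1 / 3) + R\<^sup>2 * real T powr (2 / 3) / 2 + M\<^sup>2 / 2) / e" for T
    have fit: "dynamic_fit g (x T) T \<le> K\<^sup>2 * F T" if T: "T \<ge> 1" for T
    proof -
      have "dynamic_fit g (x T) T \<le> L T / \<alpha> T"
        using mosp.dynamic_fit_le[OF mosp[OF T]] L[OF T] by simp
      \<comment> \<open>Equal stepsizes cancel in the \<mu> terms, and the diameter term acquires
        the inverse square of \<open>\<alpha> T\<close>.\<close>
      also have "\<dots> = M + (2 * G * R * (1 / \<alpha> T) + R\<^sup>2 / 2 * (1 / (\<alpha> T)\<^sup>2) + M\<^sup>2 / 2) / e"
        using stepsize_pos[OF T] e by (simp add: L_def field_simps power2_eq_square)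
      also have "\<dots> \<le> K\<^sup>2 * M + (2 * G * R * (K\<^sup>2 * real T powr (1 / 3))
          + R\<^sup>2 / 2 * (K\<^sup>2 * real T powr (2 / 3)) + K\<^sup>2 * (M\<^sup>2 / 2)) / e"
      proof -
        have "1 * M \<le> K\<^sup>2 * M" "1 * (M\<^sup>2 / 2) \<le> K\<^sup>2 * (M\<^sup>2 / 2)"
          using K bounds_nonneg by (intro mult_right_mono; simp)+
        moreover have "1 / \<alpha> T \<le> K\<^sup>2 * real T powr (1 / 3)"
          using inv1[OF T] mult_right_mono[OF K(2), of "real T powr (1 / 3)"] by simp
        then have "2 * G * R * (1 / \<alpha> T) \<le> 2 * G * R * (K\<^sup>2 * real T powr (1 / 3))"
          using bounds_nonneg by (intro mult_left_mono) auto
        moreover have "R\<^sup>2 / 2 * (1 / (\<alpha> T)\<^sup>2) \<le> R\<^sup>2 / 2 * (K\<^sup>2 * real T powr (2 / 3))"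
          using inv2[OF T] by (intro mult_left_mono) auto
        ultimately show ?thesis
          using e by (intro add_mono divide_right_mono) auto
      qed
      also have "\<dots> = K\<^sup>2 * F T" using e by (simp add: F_def field_simps)
      finally show ?thesis .
    qed
    have "(\<lambda>T. dynamic_fit g (x T) T) \<in> O(F)"
      using fit by (intro bigoI[of _ "K\<^sup>2"] eventually_sequentiallyI[of 1])
        (auto simp: dynamic_fit_def intro: order_trans[OF _ mult_left_mono[OF abs_ge_self]])
    also have "F \<in> O(\<lambda>T. real T powr (2 / 3))"
    proof -
      have "F = (\<lambda>T. (M + M\<^sup>2 / 2 / e) + real T powr (1 / 3) * (2 * G * R / e)
          + real T powr (2 / 3) * (R\<^sup>2 / 2 / e))"
        by (intro ext) (simp add: F_def add_divide_distrib mult.commute)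
      also have "\<dots> \<in> O(\<lambda>T. real T powr (2 / 3))"
      proof (intro sum_in_bigo)
        show "(\<lambda>T. M) \<in> O(\<lambda>T. real T powr (2 / 3))"
          "(\<lambda>T. M\<^sup>2 / 2 / e) \<in> O(\<lambda>T. real T powr (2 / 3))"
          by (rule landau_o.big.trans[OF bigo_const]; real_asymp)+
        show "(\<lambda>T. real T powr (1 / 3) * (2 * G * R / e)) \<in> O(\<lambda>T. real T powr (2 / 3))"
          unfolding cmult_in_bigo_iff' by (rule disjI2) real_asymp
        show "(\<lambda>T. real T powr (2 / 3) * (R\<^sup>2 / 2 / e)) \<in> O(\<lambda>T. real T powr (2 / 3))"
          unfolding cmult_in_bigo_iff' by simp
      qed
      finally show ?thesis .
    qed
    finally have fit_order: "(\<lambda>T. dynamic_fit g (x T) T) \<in> O(\<lambda>T. real T powr (2 / 3))" .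
    have regret_order: "(\<lambda>T. max (dynamic_regret f (x T) xs T) 0) \<in> o(\<lambda>T. real T)"
      if mv: "minimizer_variation xs \<in> o(\<lambda>T. real T powr (2 / 3))"
        and tv: "total_variation X g \<in> o(\<lambda>T. real T powr (2 / 3))"
    proof -
      \<comment> \<open>The bound of \<open>dynamic_regret_le\<close> at \<open>n = T\<close> with
        equal stepsizes, arranged into products whose orders are known.\<close>
      define B where "B T = \<alpha> T * real T * (G\<^sup>2 / 2 + M\<^sup>2 / 2) + \<alpha> T * (M\<^sup>2 / 2)
        + L T * total_variation X g T
        + (1 / \<alpha> T) * (3 / 2 * R\<^sup>2) + (1 / \<alpha> T) * minimizer_variation xs T * R" for T
      have \<alpha>_small: "(\<lambda>T. \<alpha> T * k T) \<in> o(\<lambda>T. real T)" if "k \<in> O(\<lambda>T. real T)" for k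
      proof -
        have "(\<lambda>T. \<alpha> T * k T) \<in> O(\<lambda>T. real T powr (- 1 / 3) * real T)"
          by (rule landau_o.big_mult[OF \<alpha>_bigo that])
        also have "(\<lambda>T. real T powr (- 1 / 3) * real T) \<in> o(\<lambda>T. real T)" by real_asymp
        finally show ?thesis .
      qed
      have \<alpha>_third: "\<alpha> \<in> O(\<lambda>T. real T powr (1 / 3))"
        by (rule landau_o.big.trans[OF \<alpha>_bigo]) real_asymp
      \<comment> \<open>Sorted by powers of \<alpha>; the inverse power dominates and fixes the
        order of \<open>L\<close>.\<close>
      have "L = (\<lambda>T. \<alpha> T * (M + M\<^sup>2 / 2 / e) + 2 * G * R / e + 1 / \<alpha> T * (R\<^sup>2 / 2 / e))"
        using e by (intro ext) (simp add: L_def add_divide_distrib algebra_simps)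
      also have "\<dots> \<in> O(\<lambda>T. real T powr (1 / 3))"
      proof (intro sum_in_bigo)
        show "(\<lambda>T. \<alpha> T * (M + M\<^sup>2 / 2 / e)) \<in> O(\<lambda>T. real T powr (1 / 3))"
          using \<alpha>_third unfolding cmult_in_bigo_iff' by simp
        show "(\<lambda>T. 1 / \<alpha> T * (R\<^sup>2 / 2 / e)) \<in> O(\<lambda>T. real T powr (1 / 3))"
          using inv_bigo unfolding cmult_in_bigo_iff' by simp
      qed real_asymp
      finally have L_order: "L \<in> O(\<lambda>T. real T powr (1 / 3))" .
      have "B \<in> o(\<lambda>T. real T)"
        unfolding B_def
      proof (intro sum_in_smallo)
        show "(\<lambda>T. \<alpha> T * real T * (G\<^sup>2 / 2 + M\<^sup>2 / 2)) \<in> o(\<lambda>T. real T)"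
          unfolding mult.assoc by (rule \<alpha>_small) simp
        show "(\<lambda>T. \<alpha> T * (M\<^sup>2 / 2)) \<in> o(\<lambda>T. real T)"
          by (rule \<alpha>_small) real_asymp
        show "(\<lambda>T. L T * total_variation X g T) \<in> o(\<lambda>T. real T)"
          by (rule third_power_mult_smallo[OF L_order tv])
        show "(\<lambda>T. 1 / \<alpha> T * (3 / 2 * R\<^sup>2)) \<in> o(\<lambda>T. real T)"
          by (rule third_power_mult_smallo[OF inv_bigo]) real_asymp
        show "(\<lambda>T. 1 / \<alpha> T * minimizer_variation xs T * R) \<in> o(\<lambda>T. real T)"
          using third_power_mult_smallo[OF inv_bigo mv] unfolding cmult_in_smallo_iff' by simp
      qed
      moreover have "norm (max (dynamic_regret f (x T) xs T) 0) \<le> norm (B T)" if T: "T \<ge> 1" for T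
      proof -
        have "dynamic_regret f (x T) xs T \<le> B T"
          using mosp.dynamic_regret_le[OF mosp[OF T], of xs T] minimizers
          unfolding L[OF T] B_def by (simp add: algebra_simps add_divide_distrib)
        \<comment> \<open>If the regret is positive, so is \<open>B T\<close>; otherwise the
          truncated regret is 0.\<close>
        then show ?thesis by (simp add: max_def)
      qed
      then have "(\<lambda>T. max (dynamic_regret f (x T) xs T) 0) \<in> O(B)"
        by (intro landau_o.big_mono eventually_sequentiallyI[of 1])
      ultimately show ?thesis by (rule landau_o.big_small_trans[rotated])
    qed
    show "(\<forall>T\<ge>1. dynamic_fit g (x T) T
          \<le> K\<^sup>2 * (M + (2 * G * R * real T powr (1 / 3) + R\<^sup>2 * real T powr (2 / 3) / 2 + M\<^sup>2 / 2)
                     / (\<epsilon> - max_variation X g))) \<and>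
      (\<lambda>T. dynamic_fit g (x T) T) \<in> O(\<lambda>T. real T powr (2 / 3)) \<and>
      (minimizer_variation xs \<in> o(\<lambda>T. real T powr (2 / 3)) \<longrightarrow>
       total_variation X g \<in> o(\<lambda>T. real T powr (2 / 3)) \<longrightarrow>
       (\<lambda>T. max (dynamic_regret f (x T) xs T) 0) \<in> o(\<lambda>T. real T))"
      using fit fit_order regret_order by (auto simp: F_def e_def)
  qed
qed

end
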